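(* Let $k \geq 14$ be an integer. Then $N(k,5) \geq 6k+4$. If, additionally, $k \equiv 5 \pmod{10}$, then $N(k,5) \geq 6k+5$.
   Context: A $k$-power is a word of the form $u^k$ (concatenation of $k$ copies of $u$) with $u$ nonempty. A $5$-antipower is a word $u_1 \cdots u_5$ with $|u_1| = \cdots = |u_5|$ and $u_1,\dots,u_5$ pairwise distinct. $N(k,r)$ is the smallest integer $\ell$ such that every binary word of length $\ell$ contains either a $k$-power or an $r$-antipower as a factor (contiguous subword). *)

theory Defs
  imports Main "HOL-Library.Sublist" "HOL-Library.Extended_Nat"
begin

definition is_power :: "nat \<Rightarrow> 'a list \<Rightarrow> bool" where
  "is_power k v \<longleftrightarrow> (\<exists>u. u \<noteq> [] \<and> v = concat (replicate k u))"

definition is_antipower :: "nat \<Rightarrow> 'a list \<Rightarrow> bool" where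
  "is_antipower r v \<longleftrightarrow> (\<exists>us. length us = r \<and> (\<forall>u\<in>set us. length u = length (hd us))
      \<and> distinct us \<and> v = concat us)"

definition avoids_or_contains :: "nat \<Rightarrow> nat \<Rightarrow> nat \<Rightarrow> bool" where
  "avoids_or_contains k r l \<longleftrightarrow> (\<forall>w :: bool list. length w = l \<longrightarrow>
      (\<exists>v. sublist v w \<and> (is_power k v \<or> is_antipower r v)))"

text \<open>N(k,r): least l such that every binary word of length l contains a k-power or an
  r-antipower as a factor; valued in enat, infinite if no such l exists.\<close>
definition N :: "nat \<Rightarrow> nat \<Rightarrow> enat" where
  "N k r = Inf (enat ` {l. avoids_or_contains k r l})"

end

theory Submission
  imports Defs
begin

text \<open>
  The witnesses are perturbations of the alternating word: the letter at position \<open>i\<close> is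
  \<open>odd i \<noteq> \<phi> i\<close> for a phase \<open>\<phi>\<close> that changes value only around three or four
  places. Two blocks of equal length on which \<open>\<phi>\<close> is constant coincide as soon as their
  first letters agree, and among five consecutive blocks there are always two such blocks.
  For odd \<open>k\<close> the phase marks the multiples of \<open>2k\<close> and the word lives on the positions
  \<open>1, \<dots>, 6k + 3\<close>; if \<open>k \<equiv> 5 (mod 10)\<close> the position \<open>0\<close> can be added, because five
  blocks starting there end before the mark at \<open>6k\<close>. For even \<open>k\<close> the phase is the
  indicator of \<open>{k + 2..5k} - {3k + 1}\<close> and the positions are \<open>0, \<dots>, 6k + 2\<close>.
\<close>

section \<open>Lower bounds from avoiding words; factors as intervals of positions\<close>

lemma N_ge_if_avoiding_word:
  fixes w :: "bool list"
  assumes "\<And>v. sublist v w \<Longrightarrow> \<not> is_power k v \<and> \<not> is_antipower r v"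
  shows "N k r \<ge> enat (Suc (length w))"
  unfolding N_def
proof (rule Inf_greatest)
  fix x assume "x \<in> enat ` {l. avoids_or_contains k r l}"
  then obtain l where x: "x = enat l" and l: "avoids_or_contains k r l" by blast
  have "l > length w"
  proof (rule ccontr)
    assume "\<not> l > length w"
    \<comment> \<open>Avoidance passes to prefixes, so \<open>w\<close> refutes every
      \<open>l\<close> up to its own length, as a bound on an infimum requires.\<close>
    then have "length (take l w) = l" by simp
    with l obtain v where "sublist v (take l w)" "is_power k v \<or> is_antipower r v"
      unfolding avoids_or_contains_def by blast
    moreover have "sublist (take l w) w" by simp
    ultimately show False
      using assms sublist_order.order_trans by blast
  qed
  then show "enat (Suc (length w)) \<le> x" using x by simp
qed

text \<open>Turns a factor into an interval of positions, so that later arguments deal only with the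
  letter function. The bound \<open>max a b\<close> covers an empty range, where
  \<open>s = a\<close> and \<open>l = 0\<close>.\<close>

lemma sublist_map_upt:
  assumes "sublist v (map f [a..<b])"
  obtains s l where "a \<le> s" "s + l \<le> max a b" "v = map f [s..<s + l]"
proof -
  from assms obtain p q where pq: "map f [a..<b] = p @ v @ q"
    unfolding sublist_def by blast
  from arg_cong[OF pq, of length] have len: "length p + length v + length q = b - a"
    by simp
  have "v = take (length v) (drop (length p) (map f [a..<b]))"
    by (simp add: pq)
  also have "\<dots> = map f [a + length p..<a + length p + length v]"
  proof (cases "v = []")
    case False
    then have "a + length p + length v \<le> b" using len by (cases "length v") auto
    then show ?thesis by (simp add: drop_map take_map take_upt)
  qed simp
  finally show thesis
    using len by (intro that[of "a + length p" "length v"]) auto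
qed

lemma power_periodic:
  assumes "is_power k (map f [s..<s + l])" "k > 0"
  obtains p where "p > 0" "l = k * p" "\<And>i. s \<le> i \<Longrightarrow> i + p < s + l \<Longrightarrow> f i = f (i + p)"
proof -
  from assms obtain u where u: "u \<noteq> []" and v: "map f [s..<s + l] = concat (replicate k u)"
    unfolding is_power_def by blast
  have l: "l = k * length u"
    using arg_cong[OF v, of length] by (simp add: length_concat sum_list_replicate)
  from \<open>k > 0\<close> obtain k' where k: "k = Suc k'" using gr0_implies_Suc by blast
  \<comment> \<open>One copy of \<open>u\<close> can be split off at either end: the first form
    shows at \<open>t + length u\<close> the letter that the second shows at
    \<open>t\<close>.\<close>
  have v1: "map f [s..<s + l] = u @ concat (replicate k' u)"
    and v2: "map f [s..<s + l] = concat (replicate k' u) @ u"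
    unfolding v k by (simp, simp flip: replicate_append_same)
  have "f i = f (i + length u)" if "s \<le> i" "i + length u < s + l" for i
  proof -
    define t where "t = i - s"
    have t: "i = s + t" "t + length u < l" using that by (auto simp: t_def)
    then have "t < length (concat (replicate k' u))"
      by (simp add: length_concat sum_list_replicate l k)
    then have "map f [s..<s + l] ! (t + length u) = map f [s..<s + l] ! t"
      by (subst v1, subst v2) (simp add: nth_append)
    then show ?thesis using t by (simp add: add.assoc)
  qed
  with l u show thesis by (intro that[of "length u"]) auto
qed

lemma nth_concat_equal_lengths:
  assumes "\<forall>u\<in>set us. length u = m" "i < length us" "t < m"
  shows "concat us ! (i * m + t) = us ! i ! t"
  using assms
proof (induction us arbitrary: i)
  case (Cons u us)
  then show ?case by (cases i) (auto simp: nth_append)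
qed simp

lemma antipower_blocks_differ:
  assumes "is_antipower r (map f [s..<s + l])" "r > 0"
  obtains m where "l = r * m"
    "\<And>i j. i < j \<Longrightarrow> j < r \<Longrightarrow> \<exists>t<m. f (s + i * m + t) \<noteq> f (s + j * m + t)"
proof -
  from assms obtain us where us: "length us = r" "\<forall>u\<in>set us. length u = length (hd us)"
    "distinct us" and v: "map f [s..<s + l] = concat us"
    unfolding is_antipower_def by blast
  define m where "m = length (hd us)"
  have "map length us = replicate r m"
    using us by (intro nth_equalityI) (simp_all add: m_def)
  then have l: "l = r * m"
    using arg_cong[OF v, of length] by (simp add: length_concat sum_list_replicate)
  have letter: "us ! i ! t = f (s + i * m + t)" if "i < r" "t < m" for i t
  proof -
    have "i * m + t < Suc i * m" using that by simp
    also have "\<dots> \<le> l" unfolding l using that by (intro mult_right_mono) auto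
    finally have "map f [s..<s + l] ! (i * m + t) = f (s + i * m + t)"
      by (simp add: add.assoc)
    then show ?thesis
      using nth_concat_equal_lengths[of us m i t] us that by (simp add: v m_def)
  qed
  have "\<exists>t<m. f (s + i * m + t) \<noteq> f (s + j * m + t)" if "i < j" "j < r" for i j
  proof (rule ccontr)
    assume "\<not> ?thesis"
    then have "us ! i = us ! j"
      using us that letter by (intro nth_equalityI) (auto simp: m_def)
    then show False using us that by (simp add: nth_eq_iff_index_eq)
  qed
  with l show thesis by (rule that)
qed

section \<open>Alternating words twisted by a phase\<close>

definition twist :: "(nat \<Rightarrow> bool) \<Rightarrow> nat \<Rightarrow> bool" where
  "twist \<phi> i \<longleftrightarrow> odd i \<noteq> \<phi> i"

text \<open>Where the phase is constant the word alternates, so two such blocks coincide exactly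
  when the parity of their distance matches the change of phase. For \<open>m = 0\<close> the
  premises are vacuous, so the conclusion \<open>m > 0\<close> also rules out empty blocks.\<close>

lemma twist_antipower:
  assumes "is_antipower r (map (twist \<phi>) [s..<s + l])" "r > 0"
  obtains m where "l = r * m"
    "\<And>i j c d. i < j \<Longrightarrow> j < r \<Longrightarrow> \<forall>t<m. \<phi> (s + i * m + t) = c \<Longrightarrow>
      \<forall>t<m. \<phi> (s + j * m + t) = d \<Longrightarrow> m > 0 \<and> odd ((j - i) * m) \<noteq> (c \<noteq> d)"
proof -
  obtain m where l: "l = r * m" and
    m: "\<And>i j. i < j \<Longrightarrow> j < r \<Longrightarrow> \<exists>t<m. twist \<phi> (s + i * m + t) \<noteq> twist \<phi> (s + j * m + t)"
    using antipower_blocks_differ[OF assms] by metis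
  have "m > 0 \<and> odd ((j - i) * m) \<noteq> (c \<noteq> d)"
    if "i < j" "j < r" "\<forall>t<m. \<phi> (s + i * m + t) = c" "\<forall>t<m. \<phi> (s + j * m + t) = d"
    for i j c d
  proof -
    from m[OF that(1,2)] obtain t where "t < m"
      "twist \<phi> (s + i * m + t) \<noteq> twist \<phi> (s + j * m + t)" by blast
    then show ?thesis using that by (auto simp: twist_def)
  qed
  with l show thesis by (rule that)
qed

text \<open>A shift by an odd period flips \<open>odd i\<close>, so the phase has to flip as well;
  for an even period the phase itself is periodic.\<close>

lemma twist_power:
  assumes "is_power k (map (twist \<phi>) [s..<s + l])" "k > 0"
  obtains p where "p > 0" "l = k * p"
    "\<And>i. s \<le> i \<Longrightarrow> i + p < s + l \<Longrightarrow> \<phi> (i + p) = (odd p \<noteq> \<phi> i)"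
proof -
  obtain p where "p > 0" "l = k * p" and
    p: "\<And>i. s \<le> i \<Longrightarrow> i + p < s + l \<Longrightarrow> twist \<phi> i = twist \<phi> (i + p)"
    using power_periodic[OF assms] by metis
  have "\<phi> (i + p) = (odd p \<noteq> \<phi> i)" if "s \<le> i" "i + p < s + l" for i
    using p[OF that] by (auto simp: twist_def)
  with \<open>p > 0\<close> \<open>l = k * p\<close> show thesis by (rule that)
qed

section \<open>The two phases: no powers, then no antipowers\<close>

definition marks :: "nat \<Rightarrow> nat \<Rightarrow> bool" where
  "marks k i \<longleftrightarrow> i \<in> {0, 2 * k, 4 * k, 6 * k}"

text \<open>Symmetric about the hole \<open>3 * k + 1\<close>, the centre of the positions
  \<open>0, ..., 6 * k + 2\<close>. The stretches of constant phase have lengths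
  \<open>k + 2\<close>, \<open>2 * k - 1\<close>, \<open>1\<close>, \<open>2 * k - 1\<close>,
  \<open>k + 2\<close>, all below \<open>2 * k\<close>, the least length of a power with even
  period.\<close>

definition plateau :: "nat \<Rightarrow> nat \<Rightarrow> bool" where
  "plateau k i \<longleftrightarrow> k + 2 \<le> i \<and> i \<le> 5 * k \<and> i \<noteq> 3 * k + 1"

lemma period_less_7:
  fixes k :: nat
  assumes "s + k * p \<le> 6 * k + 4" "k \<ge> 14"
  shows "p < 7"
proof (rule ccontr)
  assume "\<not> p < 7"
  then have "k * 7 \<le> k * p" by simp
  with assms show False by linarith
qed

lemma marks_no_power:
  assumes "k \<ge> 14" "s + l \<le> 6 * k + 4"
  shows "\<not> is_power k (map (twist (marks k)) [s..<s + l])"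
proof
  assume "is_power k (map (twist (marks k)) [s..<s + l])"
  then obtain p where p: "p > 0" "l = k * p"
    and per: "\<And>i. s \<le> i \<Longrightarrow> i + p < s + l \<Longrightarrow> marks k (i + p) = (odd p \<noteq> marks k i)"
    by (rule twist_power) (use assms in auto)
  have "p < 7" using period_less_7[of s k p] assms p by simp
  show False
  proof (cases "odd p")
    case True
    \<comment> \<open>Exactly one of \<open>s\<close>, \<open>s + p\<close> is a mark, and exactly
      one of \<open>s + 2 * p\<close>, \<open>s + 3 * p\<close>. These two marks are closer than the
      spacing \<open>2 * k\<close>.\<close>
    have "5 * p < k * p" using assms p by simp
    then have "marks k (s + p) \<noteq> marks k s" "marks k (s + 3 * p) \<noteq> marks k (s + 2 * p)"
      using per[of s] per[of "s + 2 * p"] True p by (auto simp: algebra_simps)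
    moreover have "3 * p < 2 * k" using \<open>p < 7\<close> assms by simp
    moreover have unique: "\<not> (marks k x \<and> marks k y)" if "x < y" "y < x + 2 * k" for x y
      using that unfolding marks_def by auto
    ultimately show False
      using unique[of s "s + 2 * p"] unique[of s "s + 3 * p"]
        unique[of "s + p" "s + 2 * p"] unique[of "s + p" "s + 3 * p"] p(1) by simp
  next
    case False
    \<comment> \<open>A mark inside the factor has a position at distance \<open>p\<close> inside it
      too, which by periodicity would be a mark; but \<open>p\<close> is below the spacing.\<close>
    have "\<not> (s \<le> c \<and> c < s + l)" if c: "c = 0 \<or> c = 2 * k \<or> c = 4 * k \<or> c = 6 * k" for c
    proof
      assume "s \<le> c \<and> c < s + l"
      moreover have "2 * p \<le> l" using p assms by simp
      ultimately have "c + p < s + l \<or> (c = (c - p) + p \<and> s \<le> c - p)" by auto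
      then consider "c + p < s + l" | e where "c = e + p" "s \<le> e" by blast
      then show False
      proof cases
        case 1
        have "marks k c" "\<not> marks k (c + p)"
          using c \<open>p < 7\<close> p(1) assms(1) unfolding marks_def by auto
        then show False using per[of c] 1 \<open>s \<le> c \<and> c < s + l\<close> False by simp
      next
        case (2 e)
        have "marks k c" "\<not> marks k e"
          using c 2(1) \<open>p < 7\<close> p(1) assms(1) unfolding marks_def by auto
        then show False using per[of e] 2 \<open>s \<le> c \<and> c < s + l\<close> False by simp
      qed
    qed
    then have *: "s \<le> c \<Longrightarrow> s + l \<le> c" if "c = 0 \<or> c = 2 * k \<or> c = 4 * k \<or> c = 6 * k" for c
      using that linorder_not_less by blast
    \<comment> \<open>A factor without marks fits between consecutive marks or beyond the last
      one.\<close>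
    consider "s = 0" | "0 < s" "s \<le> 2 * k" | "2 * k < s" "s \<le> 4 * k"
      | "4 * k < s" "s \<le> 6 * k" | "6 * k < s" by linarith
    then have "l < 2 * k"
      using *[of 0] *[of "2 * k"] *[of "4 * k"] *[of "6 * k"] assms by cases auto
    moreover have "p \<ge> 2" using False p by presburger
    ultimately show False using p by simp
  qed
qed

lemma plateau_no_power:
  assumes "k \<ge> 14" "s + l \<le> 6 * k + 3"
  shows "\<not> is_power k (map (twist (plateau k)) [s..<s + l])"
proof
  assume "is_power k (map (twist (plateau k)) [s..<s + l])"
  then obtain p where p: "p > 0" "l = k * p"
    and per: "\<And>i. s \<le> i \<Longrightarrow> i + p < s + l \<Longrightarrow> plateau k (i + p) = (odd p \<noteq> plateau k i)"
    by (rule twist_power) (use assms in auto)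
  have "p < 7" using period_less_7[of s k p] assms p by simp
  show False
  proof (cases "odd p")
    case True
    have "plateau k (s + (j + 1) * p) \<noteq> plateau k (s + j * p)" if "j < 5" for j
    proof -
      have "(j + 1) * p < k * p" using that assms p by (intro mult_strict_right_mono) auto
      then show ?thesis using per[of "s + j * p"] True p by (simp add: algebra_simps)
    qed
    from this[of 0] this[of 1] this[of 2] this[of 3] this[of 4]
    have changes: "plateau k (s + p) \<noteq> plateau k s" "plateau k (s + 2 * p) \<noteq> plateau k (s + p)"
      "plateau k (s + 3 * p) \<noteq> plateau k (s + 2 * p)"
      "plateau k (s + 4 * p) \<noteq> plateau k (s + 3 * p)"
      "plateau k (s + 5 * p) \<noteq> plateau k (s + 4 * p)"
      by (simp_all del: One_nat_def)
    \<comment> \<open>\<open>stage\<close> numbers the five stretches of constant phase, with odd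
      numbers on the plateau. Five flips in a row would need a sixth stretch.\<close>
    define stage :: "nat \<Rightarrow> nat" where "stage x = (if x < k + 2 then 0 else
      if x < 3 * k + 1 then 1 else if x = 3 * k + 1 then 2 else if x \<le> 5 * k then 3 else 4)" for x
    have "plateau k x \<longleftrightarrow> odd (stage x)" for x
      using assms(1) unfolding stage_def plateau_def by simp
    moreover have "stage x \<le> stage y" if "x \<le> y" for x y
      using that assms(1) unfolding stage_def by simp
    ultimately have increase: "stage x < stage y" if "x \<le> y" "plateau k y \<noteq> plateau k x" for x y
      using that by (metis le_neq_implies_less)
    have "stage s < stage (s + p)" "stage (s + p) < stage (s + 2 * p)"
      "stage (s + 2 * p) < stage (s + 3 * p)" "stage (s + 3 * p) < stage (s + 4 * p)"
      "stage (s + 4 * p) < stage (s + 5 * p)"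
      by (rule increase; use changes in simp)+
    moreover have "stage (s + 5 * p) \<le> 4" unfolding stage_def by simp
    ultimately show False by linarith
  next
    case False
    \<comment> \<open>Phases that differ at distance \<open>p\<close> cap the end of the factor.
      Applied near each change of phase, this leaves no start \<open>s\<close> with room for
      \<open>2 * k\<close> letters.\<close>
    have *: "s + l \<le> i + p" if "plateau k i \<noteq> plateau k (i + p)" "s \<le> i" for i
      using per[of i] that False by (metis linorder_not_less)
    from False have "p = 2 \<or> p = 4 \<or> p = 6" using p \<open>p < 7\<close> by presburger
    moreover have "s + l \<le> k + 1 + p" if "s \<le> k + 1"
      using *[of "k + 1"] that p(1) \<open>p < 7\<close> assms(1) unfolding plateau_def by simp
    moreover have "s + l \<le> 3 * k + 1" if "s + p \<le> 3 * k + 1"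
    proof -
      \<comment> \<open>Here \<open>i + p\<close> is the hole while \<open>i\<close> lies on the
        plateau.\<close>
      define i where "i = 3 * k + 1 - p"
      then have "3 * k + 1 = i + p" using \<open>p < 7\<close> assms(1) by simp
      then show ?thesis
        using *[of i] that p(1) \<open>p < 7\<close> assms(1) unfolding plateau_def by simp
    qed
    moreover have "s + l \<le> 3 * k + 1 + p" if "s \<le> 3 * k + 1"
      using *[of "3 * k + 1"] that p(1) \<open>p < 7\<close> assms(1) unfolding plateau_def by simp
    moreover have "s + l \<le> 5 * k + p" if "s \<le> 5 * k"
      using *[of "5 * k"] that p(1) \<open>p < 7\<close> assms(1) unfolding plateau_def by simp
    moreover have "s + l \<le> 5 * k + 1" if "s + p \<le> 5 * k + 1"
    proof -
      define i where "i = 5 * k + 1 - p"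
      then have "5 * k + 1 = i + p" using \<open>p < 7\<close> assms(1) by simp
      then show ?thesis
        using *[of i] that p(1) \<open>p < 7\<close> assms(1) unfolding plateau_def by simp
    qed
    ultimately show False using p(2) assms by (elim disjE) (simp; linarith)+
  qed
qed

text \<open>Three marks hit at most three of the five blocks, so two are clean, which suffices for
  even \<open>m\<close>. For odd \<open>m\<close> failure means that two of the blocks 0, 2, 4 and
  one of 1, 3 are hit. If \<open>s > 0\<close>, the spacing leaves only blocks 1, 2, 4, and then
  \<open>m = k + 1\<close>, which is even as \<open>k\<close> is odd. If \<open>s = 0\<close>, block
  0 is hit by the mark 0 and no such pattern fits.\<close>

lemma marks_clean_pair:
  fixes k s m :: int and clean :: "int \<Rightarrow> bool"
  assumes k: "k \<ge> 14" "odd k" and m: "m > 0" and s: "s \<ge> 0" "s + 5 * m \<le> 6 * k + 4"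
    and C: "s > 0 \<and> C = {2 * k, 4 * k, 6 * k} \<or> s = 0 \<and> 5 * m \<le> 6 * k \<and> C = {0, 2 * k, 4 * k}"
    and clean: "\<And>x. clean x \<longleftrightarrow> (\<forall>c\<in>C. x + m \<le> c \<or> c < x)"
  obtains i j :: nat where "i < j" "j < 5" "even ((j - i) * nat m)"
    "clean (s + int i * m)" "clean (s + int j * m)"
proof -
  have "\<exists>i j :: nat. i < j \<and> j < 5 \<and> even ((j - i) * nat m) \<and>
    clean (s + int i * m) \<and> clean (s + int j * m)"
  proof (rule ccontr)
    assume contra: "\<not> ?thesis"
    have clash: "\<not> (clean (s + int i * m) \<and> clean (s + int j * m))"
      if "i < j" "j < 5" "even ((j - i) * nat m)" for i j :: nat
      using that contra by blast
    have even_gap: "\<not> (clean s \<and> clean (s + 2 * m))" "\<not> (clean s \<and> clean (s + 4 * m))"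
      "\<not> (clean (s + 2 * m) \<and> clean (s + 4 * m))" "\<not> (clean (s + m) \<and> clean (s + 3 * m))"
      using clash[of 0 2] clash[of 0 4] clash[of 2 4] clash[of 1 3] by simp_all
    show False
    proof (cases "even m")
      case True
      then have "even (nat m)" using m by (simp add: even_nat_iff)
      then have odd_gap: "\<not> (clean s \<and> clean (s + m))" "\<not> (clean s \<and> clean (s + 3 * m))"
        "\<not> (clean (s + m) \<and> clean (s + 2 * m))" "\<not> (clean (s + m) \<and> clean (s + 4 * m))"
        "\<not> (clean (s + 2 * m) \<and> clean (s + 3 * m))" "\<not> (clean (s + 3 * m) \<and> clean (s + 4 * m))"
        using clash[of 0 1] clash[of 0 3] clash[of 1 2] clash[of 1 4] clash[of 2 3] clash[of 3 4]
        by simp_all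
      from C show False
      proof (elim disjE conjE)
        assume "s > 0" and C: "C = {2 * k, 4 * k, 6 * k}"
        have "clean x \<longleftrightarrow> (x + m \<le> 2 * k \<or> 2 * k < x) \<and> (x + m \<le> 4 * k \<or> 4 * k < x) \<and>
            (x + m \<le> 6 * k \<or> 6 * k < x)" for x
          unfolding clean C by simp
        then show False using even_gap odd_gap k(1) m s by (smt (z3))
      next
        assume "s = 0" "5 * m \<le> 6 * k" and C: "C = {0, 2 * k, 4 * k}"
        have "clean x \<longleftrightarrow> (x + m \<le> 0 \<or> 0 < x) \<and> (x + m \<le> 2 * k \<or> 2 * k < x) \<and>
            (x + m \<le> 4 * k \<or> 4 * k < x)" for x
          unfolding clean C by simp
        then show False using \<open>s = 0\<close> \<open>5 * m \<le> 6 * k\<close> even_gap odd_gap k(1) m s by (smt (z3))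
      qed
    next
      case False
      \<comment> \<open>Writing out the parities turns the remaining claim into linear integer
        arithmetic.\<close>
      then obtain r where r: "m = 2 * r + 1" by (rule oddE)
      obtain q where q: "k = 2 * q + 1" using k(2) by (rule oddE)
      from C show False
      proof (elim disjE conjE)
        assume "s > 0" and C: "C = {2 * k, 4 * k, 6 * k}"
        have "clean x \<longleftrightarrow> (x + m \<le> 2 * k \<or> 2 * k < x) \<and> (x + m \<le> 4 * k \<or> 4 * k < x) \<and>
            (x + m \<le> 6 * k \<or> 6 * k < x)" for x
          unfolding clean C by simp
        then show False using even_gap k(1) m s q r by (smt (z3))
      next
        assume "s = 0" "5 * m \<le> 6 * k" and C: "C = {0, 2 * k, 4 * k}"
        have "clean x \<longleftrightarrow> (x + m \<le> 0 \<or> 0 < x) \<and> (x + m \<le> 2 * k \<or> 2 * k < x) \<and>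
            (x + m \<le> 4 * k \<or> 4 * k < x)" for x
          unfolding clean C by simp
        then show False using \<open>s = 0\<close> \<open>5 * m \<le> 6 * k\<close> even_gap k(1) m s q r by (smt (z3))
      qed
    qed
  qed
  then show thesis using that by blast
qed

lemma marks_no_antipower:
  assumes "k \<ge> 14" "odd k" "s + l \<le> 6 * k + 4" "s > 0 \<or> k mod 10 = 5"
  shows "\<not> is_antipower 5 (map (twist (marks k)) [s..<s + l])"
proof
  assume "is_antipower 5 (map (twist (marks k)) [s..<s + l])"
  then obtain m where l: "l = 5 * m" and m: "\<And>i j c d. i < j \<Longrightarrow> j < 5 \<Longrightarrow>
      \<forall>t<m. marks k (s + i * m + t) = c \<Longrightarrow>
      \<forall>t<m. marks k (s + j * m + t) = d \<Longrightarrow> m > 0 \<and> odd ((j - i) * m) \<noteq> (c \<noteq> d)"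
    by (rule twist_antipower[OF _ zero_less_numeral]) (rule that)
  have "m > 0"
    using m[of 0 1] by (cases m) auto
  have len: "s + 5 * m \<le> 6 * k + 4" using assms l by simp
  \<comment> \<open>Now 5 divides \<open>6 * k\<close>, so no multiple of 5 lies in
    \<open>6 * k + 1, ..., 6 * k + 4\<close>.\<close>
  have short: "5 * m \<le> 6 * k" if "s = 0"
    using that assms(4) len by presburger
  \<comment> \<open>The three marks that blocks can meet: a start \<open>s > 0\<close> is past the
    mark 0, and blocks starting at 0 end before \<open>6 * k\<close>.\<close>
  define C where "C = (if s > 0 then {2 * int k, 4 * int k, 6 * int k} else {0, 2 * int k, 4 * int k})"
  define clean where "clean x \<longleftrightarrow> (\<forall>c\<in>C. x + int m \<le> c \<or> c < x)" for x
  have "int k \<ge> 14" "odd (int k)" "int m > 0" "int s \<ge> 0" "int s + 5 * int m \<le> 6 * int k + 4"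
    using assms len \<open>m > 0\<close> by simp_all
  moreover have "int s > 0 \<and> C = {2 * int k, 4 * int k, 6 * int k} \<or>
      int s = 0 \<and> 5 * int m \<le> 6 * int k \<and> C = {0, 2 * int k, 4 * int k}"
    using short by (auto simp: C_def)
  ultimately obtain i j where ij: "i < j" "j < 5" "even ((j - i) * nat (int m))"
      "clean (int s + int i * int m)" "clean (int s + int j * int m)"
    using clean_def by (rule marks_clean_pair)
  have unmarked: "\<forall>t<m. marks k (s + n * m + t) = False"
    if "clean (int s + int n * int m)" "n < 5" for n
  proof (intro allI impI)
    fix t assume "t < m"
    have "n * m + m \<le> 5 * m" using mult_right_mono[of "n + 1" 5 m] that(2) by simp
    then have "s = 0 \<longrightarrow> s + n * m + t < 6 * k" "s \<le> s + n * m + t"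
      using \<open>t < m\<close> short by (linarith, simp)
    moreover have "int (s + n * m + t) \<notin> C"
      using that(1) \<open>t < m\<close> unfolding clean_def by force
    moreover define x where "x = s + n * m + t"
    ultimately show "marks k (s + n * m + t) = False"
      unfolding marks_def C_def x_def[symmetric] by (auto split: if_splits)
  qed
  show False
    using m[of i j False False] unmarked[of i] unmarked[of j] ij by simp
qed

text \<open>The two edges and the hole spoil at most three blocks. Matching blocks share the phase
  (\<open>m\<close> even) or the phase combined with the parity of the index (\<open>m\<close> odd),
  so among three constant blocks two match. If only two are constant and they do not match, the
  inequalities leave only even \<open>m\<close> with blocks 0, 2, 3 or 1, 2, 4 spoiled; both force
  \<open>m = k + 1\<close>, which is odd as \<open>k\<close> is even.\<close>

lemma plateau_constant_pair:
  fixes k s m :: int and const :: "bool \<Rightarrow> int \<Rightarrow> bool"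
  assumes k: "k \<ge> 14" "even k" and m: "m > 0" and s: "s \<ge> 0" "s + 5 * m \<le> 6 * k + 3"
    and low: "\<And>x. const False x \<longleftrightarrow> x + m \<le> k + 2 \<or> 5 * k + 1 \<le> x"
    and high: "\<And>x. const True x \<longleftrightarrow> k + 2 \<le> x \<and> x + m \<le> 5 * k + 1 \<and>
      (x + m \<le> 3 * k + 1 \<or> 3 * k + 2 \<le> x)"
  obtains i j :: nat and c d where "i < j" "j < 5" "odd ((j - i) * nat m) \<longleftrightarrow> c \<noteq> d"
    "const c (s + int i * m)" "const d (s + int j * m)"
proof -
  have "\<exists>(i :: nat) (j :: nat) c d. i < j \<and> j < 5 \<and> (odd ((j - i) * nat m) \<longleftrightarrow> c \<noteq> d) \<and>
    const c (s + int i * m) \<and> const d (s + int j * m)"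
  proof (rule ccontr)
    assume contra: "\<not> ?thesis"
    have clash: "\<not> (const c (s + int i * m) \<and> const d (s + int j * m))"
      if "i < j" "j < 5" "odd ((j - i) * nat m) \<longleftrightarrow> c \<noteq> d" for i j :: nat and c d
      using that contra by blast
    obtain q where q: "k = 2 * q" using k(2) by (rule evenE)
    have even_gap: "\<not> (const c s \<and> const c (s + 2 * m))" "\<not> (const c s \<and> const c (s + 4 * m))"
      "\<not> (const c (s + 2 * m) \<and> const c (s + 4 * m))"
      "\<not> (const c (s + m) \<and> const c (s + 3 * m))" for c
      using clash[of 0 2 c c] clash[of 0 4 c c] clash[of 2 4 c c] clash[of 1 3 c c] by simp_all
    show False
    proof (cases "even m")
      case True
      then have "even (nat m)" using m by (simp add: even_nat_iff)
      then have odd_gap: "\<not> (const c s \<and> const c (s + m))" "\<not> (const c s \<and> const c (s + 3 * m))"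
        "\<not> (const c (s + m) \<and> const c (s + 2 * m))" "\<not> (const c (s + m) \<and> const c (s + 4 * m))"
        "\<not> (const c (s + 2 * m) \<and> const c (s + 3 * m))"
        "\<not> (const c (s + 3 * m) \<and> const c (s + 4 * m))" for c
        using clash[of 0 1 c c] clash[of 0 3 c c] clash[of 1 2 c c] clash[of 1 4 c c]
          clash[of 2 3 c c] clash[of 3 4 c c] by simp_all
      obtain r where r: "m = 2 * r" using True by (rule evenE)
      show False
        using even_gap[of False] even_gap[of True] odd_gap[of False] odd_gap[of True] k(1) m s q r
        unfolding low high by (smt (z3))
    next
      case False
      then have "odd (nat m)" using m by (simp add: even_nat_iff)
      then have odd_gap: "\<not> (const c s \<and> const (\<not> c) (s + m))"
        "\<not> (const c s \<and> const (\<not> c) (s + 3 * m))"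
        "\<not> (const c (s + m) \<and> const (\<not> c) (s + 2 * m))"
        "\<not> (const c (s + m) \<and> const (\<not> c) (s + 4 * m))"
        "\<not> (const c (s + 2 * m) \<and> const (\<not> c) (s + 3 * m))"
        "\<not> (const c (s + 3 * m) \<and> const (\<not> c) (s + 4 * m))" for c
        using clash[of 0 1 c "\<not> c"] clash[of 0 3 c "\<not> c"] clash[of 1 2 c "\<not> c"]
          clash[of 1 4 c "\<not> c"] clash[of 2 3 c "\<not> c"] clash[of 3 4 c "\<not> c"] by simp_all
      obtain r where r: "m = 2 * r + 1" using False by (rule oddE)
      show False
        using even_gap[of False] even_gap[of True] odd_gap[of False] odd_gap[of True] k(1) m s q r
        unfolding not_False_eq_True not_True_eq_False low high by (smt (z3))
    qed
  qed
  then show thesis using that by blast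
qed

lemma plateau_no_antipower:
  assumes "k \<ge> 14" "even k" "s + l \<le> 6 * k + 3"
  shows "\<not> is_antipower 5 (map (twist (plateau k)) [s..<s + l])"
proof
  assume "is_antipower 5 (map (twist (plateau k)) [s..<s + l])"
  then obtain m where l: "l = 5 * m" and m: "\<And>i j c d. i < j \<Longrightarrow> j < 5 \<Longrightarrow>
      \<forall>t<m. plateau k (s + i * m + t) = c \<Longrightarrow>
      \<forall>t<m. plateau k (s + j * m + t) = d \<Longrightarrow> m > 0 \<and> odd ((j - i) * m) \<noteq> (c \<noteq> d)"
    by (rule twist_antipower[OF _ zero_less_numeral]) (rule that)
  have "m > 0"
    using m[of 0 1] by (cases m) auto
  \<comment> \<open>Only a sufficient condition: a one-letter block on the hole has phase
    \<open>False\<close> but is not counted.\<close>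
  define const where "const c x \<longleftrightarrow> (if c then int k + 2 \<le> x \<and> x + int m \<le> 5 * int k + 1 \<and>
      (x + int m \<le> 3 * int k + 1 \<or> 3 * int k + 2 \<le> x)
    else x + int m \<le> int k + 2 \<or> 5 * int k + 1 \<le> x)" for c x
  have "int k \<ge> 14" "even (int k)" "int m > 0" "int s \<ge> 0" "int s + 5 * int m \<le> 6 * int k + 3"
    using assms l \<open>m > 0\<close> by simp_all
  then obtain i j c d where ij: "i < j" "j < 5" "odd ((j - i) * nat (int m)) \<longleftrightarrow> c \<noteq> d"
      "const c (int s + int i * int m)" "const d (int s + int j * int m)"
    by (rule plateau_constant_pair[where const = const]) (simp_all add: const_def)
  have on_block: "\<forall>t<m. plateau k (s + n * m + t) = c" if "const c (int s + int n * int m)" for c n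
  proof (intro allI impI)
    fix t assume "t < m"
    define x where "x = s + n * m"
    have "const c (int x)" using that by (simp add: x_def)
    with \<open>t < m\<close> show "plateau k (s + n * m + t) = c"
      unfolding const_def plateau_def x_def[symmetric] by (cases c) auto
  qed
  show False
    using m[OF ij(1,2) on_block[OF ij(4)] on_block[OF ij(5)]] ij(3)[unfolded nat_int] by blast
qed

theorem theorem15:
  fixes k :: nat
  assumes "k \<ge> 14"
  shows "N k 5 \<ge> enat (6 * k + 4) \<and> (k mod 10 = 5 \<longrightarrow> N k 5 \<ge> enat (6 * k + 5))"
proof (intro conjI impI)
  show "N k 5 \<ge> enat (6 * k + 4)"
  proof (cases "odd k")
    case True
    \<comment> \<open>Starting at position 1 makes every factor satisfy
      \<open>s > 0\<close>.\<close>
    have "N k 5 \<ge> enat (Suc (length (map (twist (marks k)) [1..<6 * k + 4])))"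
      by (rule N_ge_if_avoiding_word, erule sublist_map_upt)
        (use marks_no_power marks_no_antipower assms True in auto)
    then show ?thesis by (simp add: add.commute)
  next
    case False
    have "N k 5 \<ge> enat (Suc (length (map (twist (plateau k)) [0..<6 * k + 3])))"
      by (rule N_ge_if_avoiding_word, erule sublist_map_upt)
        (use plateau_no_power plateau_no_antipower assms False in auto)
    then show ?thesis by (simp add: add.commute)
  qed
next
  assume mod: "k mod 10 = 5"
  then have "odd k" by presburger
  \<comment> \<open>Position 0 contributes the extra letter; factors starting there are handled by
    the residue of \<open>k\<close>.\<close>
  have "N k 5 \<ge> enat (Suc (length (map (twist (marks k)) [0..<6 * k + 4])))"
    by (rule N_ge_if_avoiding_word, erule sublist_map_upt)
      (use marks_no_power marks_no_antipower assms mod \<open>odd k\<close> in auto)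
  then show "N k 5 \<ge> enat (6 * k + 5)" by (simp add: add.commute)
qed

end
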